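(* Let $k\ge 2$ and $r\ge 1$ be integers, let $\Phi=\{1,2,\dots,q\}$, let $J\in\mathbb{R}\setminus\{0\}$, and let $\mathbf{H}(\sigma)=-J\sum_{b\in M_r}U(\sigma_b)$ be the (formal) Hamiltonian on configurations $\sigma:V\to\Phi$ on the Cayley tree of order $k$. Let $GS(\mathbf{H})$ be the set of ground states of $\mathbf{H}$, and let $K=K(k,r)=1+(k-1)^{-1}(k+1)(k^r-1)$ be the number of vertices of a ball of radius $r$. 1. If $J>0$, then $GS(\mathbf{H})$ contains the constant configurations only, i.e. it consists of exactly the $q$ configurations $\sigma^{(i)}\equiv i$, $i=1,\dots,q$. 2. Let $b\in M_r$. If $q$ is large enough and $J<0$, then $GS(\mathbf{H})$ contains at least $\frac{q!}{(q-K)!}$ periodic ground states which are periodic with respect to the $(b,\mathbf{1})$-ground subgroup $H_b$. (Here "$q$ large enough" means: there is $q_0$, depending on $k$, $r$, and $H_b$, such that the assertion holds for all $q\ge q_0$.)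
   Context: Cayley tree and group. The Cayley tree $\Gamma^k=(V,L)$ of order $k$ is the infinite tree in which exactly $k+1$ edges issue from each vertex. Its vertex set $V$ is identified with the group $G_k$, the free product of $k+1$ cyclic groups $\{e,a_i\}$ of order two ($a_i^2=e$), $i=1,\dots,k+1$; vertices $x,y\in G_k$ are adjacent iff $y=xa_i$ for some $i$, so that left translations (shifts) act by tree automorphisms. For $x,y\in V$, $d(x,y)$ is the number of edges of the shortest path connecting them, $b_r(x)=\{y\in V: d(x,y)\le r\}$, and $M_r$ is the set of all balls $b_r(x)$, $x\in V$. Configurations. A configuration is a function $\sigma:V\to\Phi=\{1,\dots,q\}$; $\Omega$ is the set of all configurations and $\sigma_A$ is the restriction of $\sigma$ to $A\subset V$. For a subgroup $H\subset G_k$ of finite index, $\sigma$ is $H$-periodic (periodic with respect to $H$) if it is invariant under shifts by $H$, i.e. $\sigma(hx)=\sigma(x)$ for all $h\in H$, $x\in G_k$ (equivalently, $\sigma$ is constant on each right coset $Hx$). A configuration is periodic if it is $H$-periodic for some subgroup $H$ of finite index. Hamiltonian and ground states. For finite $A\subset V$, $U(\sigma_A)=|A|-|\sigma_A\cap\Phi|$, where $|\sigma_A\cap\Phi|$ is the number of distinct values of $\sigma_A(x)$, $x\in A$. A ground state of $\mathbf{H}$ is a periodic configuration that minimizes $\mathbf{H}$. Since $\mathbf{H}$ is a formal infinite sum, minimizing $\mathbf{H}$ is understood ball by ball: a periodic configuration $\varphi$ is a ground state iff for every $b\in M_r$, $-J\,U(\varphi_b)=\min_{\sigma\in\Omega}\bigl(-J\,U(\sigma_b)\bigr)$.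 Ground subgroups. For a finite $A\subset G_k$ and $\mathbf{1}=(1,\dots,1)$ with $|A|$ coordinates, a subgroup $H$ of $G_k$ is an $(A,\mathbf{1})$-ground subgroup if $|A|$ pairwise distinct right cosets of $H$ each meet $A$ in exactly one element, i.e. distinct elements of $A$ lie in distinct right cosets of $H$. For every $x\in G_k\setminus\{e\}$ fix a normal subgroup $H_x$ of $G_k$ of finite index not containing $x$ (such subgroups are known to exist). For finite $A\subset G_k$ with $|A|>1$ put $A^*=\{xy^{-1}: x,y\in A\}$ and $H_A=\bigcap_{x\in A^*\setminus\{e\}}H_x$; this is a normal subgroup of finite index and an $(A,\mathbf{1})$-ground subgroup. $H_b$ is this subgroup for $A=b$. *)

theory Defs
  imports Complex_Main "HOL-Library.FuncSet" "HOL-Algebra.Coset"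
begin

text \<open>
  The free product of the \<open>k + 1\<close> cyclic groups \<open>{e, a\<^sub>i}\<close> of order two is given by its normal
  forms: an element is a word over the letters \<open>1, \<dots>, k + 1\<close> without two equal neighbouring
  letters, the letter \<open>i\<close> standing for \<open>a\<^sub>i\<close>.  The product is concatenation followed by repeated
  cancellation of \<open>a\<^sub>i a\<^sub>i\<close>.
\<close>

fun letter_mult :: "nat \<Rightarrow> nat list \<Rightarrow> nat list" where
  "letter_mult a [] = [a]"
| "letter_mult a (b # w) = (if a = b then w else a # b # w)"

definition cayley_group :: "nat \<Rightarrow> nat list monoid" where
  "cayley_group k =
     \<lparr>carrier = {w. set w \<subseteq> {1..k + 1} \<and> distinct_adj w},
      mult = foldr letter_mult,
      one = []\<rparr>"

definition generator :: "nat \<Rightarrow> nat list" where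
  "generator i = [i]"

definition edges :: "nat \<Rightarrow> (nat list \<times> nat list) set" where
  "edges k = {(x, y). x \<in> carrier (cayley_group k) \<and>
     (\<exists>i\<in>{1..k + 1}. y = x \<otimes>\<^bsub>cayley_group k\<^esub> generator i)}"

text \<open>The pair \<open>(x, y)\<close> lies in \<open>edges k ^^ n\<close> iff some walk with \<open>n\<close> edges leads from \<open>x\<close> to \<open>y\<close>.\<close>

definition tree_dist :: "nat \<Rightarrow> nat list \<Rightarrow> nat list \<Rightarrow> nat" where
  "tree_dist k x y = (LEAST n. (x, y) \<in> edges k ^^ n)"

definition tree_ball :: "nat \<Rightarrow> nat \<Rightarrow> nat list \<Rightarrow> nat list set" where
  "tree_ball k r x = {y \<in> carrier (cayley_group k). tree_dist k x y \<le> r}"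

definition balls :: "nat \<Rightarrow> nat \<Rightarrow> nat list set set" where
  "balls k r = tree_ball k r ` carrier (cayley_group k)"

text \<open>The division is exact, since \<open>k - 1\<close> divides \<open>k ^ r - 1\<close>.\<close>

definition ball_size :: "nat \<Rightarrow> nat \<Rightarrow> nat" where
  "ball_size k r = 1 + ((k + 1) * (k ^ r - 1)) div (k - 1)"

text \<open>Configurations are extensional functions, so that distinct members differ at some vertex.\<close>

definition configurations :: "nat \<Rightarrow> nat \<Rightarrow> (nat list \<Rightarrow> nat) set" where
  "configurations k q = carrier (cayley_group k) \<rightarrow>\<^sub>E {1..q}"

definition periodic_wrt :: "nat \<Rightarrow> nat list set \<Rightarrow> (nat list \<Rightarrow> nat) \<Rightarrow> bool" where
  "periodic_wrt k H \<sigma> \<longleftrightarrow>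
     subgroup H (cayley_group k) \<and> finite (rcosets\<^bsub>cayley_group k\<^esub> H) \<and>
     (\<forall>h\<in>H. \<forall>x\<in>carrier (cayley_group k). \<sigma> (h \<otimes>\<^bsub>cayley_group k\<^esub> x) = \<sigma> x)"

definition periodic :: "nat \<Rightarrow> (nat list \<Rightarrow> nat) \<Rightarrow> bool" where
  "periodic k \<sigma> \<longleftrightarrow> (\<exists>H. periodic_wrt k H \<sigma>)"

definition U :: "(nat list \<Rightarrow> nat) \<Rightarrow> nat list set \<Rightarrow> real" where
  "U \<sigma> A = real (card A) - real (card (\<sigma> ` A))"

definition ground_states :: "nat \<Rightarrow> nat \<Rightarrow> nat \<Rightarrow> real \<Rightarrow> (nat list \<Rightarrow> nat) set" where
  "ground_states k r q J =
     {\<phi> \<in> configurations k q. periodic k \<phi> \<and>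
        (\<forall>b\<in>balls k r. - J * U \<phi> b = Min ((\<lambda>\<sigma>. - J * U \<sigma> b) ` configurations k q))}"

text \<open>\<open>(A, (1, \<dots>, 1))\<close>-ground subgroups.\<close>

definition ground_subgroup :: "nat \<Rightarrow> nat list set \<Rightarrow> nat list set \<Rightarrow> bool" where
  "ground_subgroup k A H \<longleftrightarrow>
     finite A \<and> subgroup H (cayley_group k) \<and>
     (\<exists>C \<subseteq> rcosets\<^bsub>cayley_group k\<^esub> H. card C = card A \<and> (\<forall>c\<in>C. card (c \<inter> A) = 1))"

text \<open>\<open>N x\<close> plays the part of \<open>H\<^sub>x\<close>; its values at \<open>e\<close> and at non-reduced words are irrelevant.\<close>

definition separating_family :: "nat \<Rightarrow> (nat list \<Rightarrow> nat list set) \<Rightarrow> bool" where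
  "separating_family k N \<longleftrightarrow>
     (\<forall>x\<in>carrier (cayley_group k) - {\<one>\<^bsub>cayley_group k\<^esub>}.
        N x \<lhd> cayley_group k \<and> finite (rcosets\<^bsub>cayley_group k\<^esub> (N x)) \<and> x \<notin> N x)"

definition quotient_set :: "nat \<Rightarrow> nat list set \<Rightarrow> nat list set" where
  "quotient_set k A = {x \<otimes>\<^bsub>cayley_group k\<^esub> inv\<^bsub>cayley_group k\<^esub> y | x y. x \<in> A \<and> y \<in> A}"

definition subgroup_of_set ::
    "nat \<Rightarrow> (nat list \<Rightarrow> nat list set) \<Rightarrow> nat list set \<Rightarrow> nat list set" where
  "subgroup_of_set k N A = (\<Inter>x\<in>quotient_set k A - {\<one>\<^bsub>cayley_group k\<^esub>}. N x)"

lemma letter_mult_distinct_adj: "distinct_adj w \<Longrightarrow> distinct_adj (letter_mult a w)"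
  by (cases w) (auto simp: distinct_adj_Cons)

lemma letter_mult_set: "set (letter_mult a w) \<subseteq> insert a (set w)"
  by (cases w) auto

lemma letter_mult_twice: "distinct_adj w \<Longrightarrow> letter_mult a (letter_mult a w) = w"
  by (cases w rule: remdups_adj.cases) auto

lemma foldr_letter_mult_distinct_adj: "distinct_adj v \<Longrightarrow> distinct_adj (foldr letter_mult u v)"
  by (induction u) (auto intro: letter_mult_distinct_adj)

lemma foldr_letter_mult_set: "set (foldr letter_mult u v) \<subseteq> set u \<union> set v"
proof (induction u)
  case (Cons a u)
  then show ?case using letter_mult_set[of a "foldr letter_mult u v"] by auto
qed simp

lemma foldr_letter_mult_Cons:
  "distinct_adj w \<Longrightarrow>
   foldr letter_mult (letter_mult a u) w = letter_mult a (foldr letter_mult u w)"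
  by (cases u) (auto simp: letter_mult_twice foldr_letter_mult_distinct_adj)

lemma foldr_letter_mult_assoc:
  "distinct_adj w \<Longrightarrow>
   foldr letter_mult (foldr letter_mult u v) w = foldr letter_mult u (foldr letter_mult v w)"
  by (induction u) (auto simp: foldr_letter_mult_Cons)

lemma foldr_letter_mult_Nil: "distinct_adj w \<Longrightarrow> foldr letter_mult w [] = w"
proof (induction w)
  case (Cons a w)
  then show ?case by (cases w) auto
qed simp

lemma foldr_letter_mult_rev: "foldr letter_mult (rev w) w = []"
proof -
  have "foldr letter_mult (rev w) (w @ v) = v" for v
    by (induction w arbitrary: v) auto
  from this[of "[]"] show ?thesis by simp
qed

lemma group_cayley_group: "group (cayley_group k)"
proof (rule groupI)
  fix x y assume "x \<in> carrier (cayley_group k)" "y \<in> carrier (cayley_group k)"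
  then show "x \<otimes>\<^bsub>cayley_group k\<^esub> y \<in> carrier (cayley_group k)"
    using foldr_letter_mult_set[of x y]
    by (auto simp: cayley_group_def foldr_letter_mult_distinct_adj)
next
  fix x assume x: "x \<in> carrier (cayley_group k)"
  show "\<exists>y\<in>carrier (cayley_group k). y \<otimes>\<^bsub>cayley_group k\<^esub> x = \<one>\<^bsub>cayley_group k\<^esub>"
    using x by (intro bexI[of _ "rev x"]) (auto simp: cayley_group_def foldr_letter_mult_rev)
qed (auto simp: cayley_group_def foldr_letter_mult_assoc)

end

theory Submission
  imports Defs
begin

text \<open>
  Up to the constants \<open>J\<close> and \<open>card b\<close>, the energy of a ball \<open>b\<close> counts the colours that occur in
  \<open>b\<close>.  For \<open>J > 0\<close> a ground state must show as few colours as possible in every ball, and a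
  constant configuration shows one; so a ground state is monochromatic on every ball.  As \<open>r \<ge> 1\<close>,
  the two ends of every edge lie in a common ball, and connectedness of the tree spreads the colour
  everywhere (\<open>ground_states_pos\<close>).

  For \<open>J < 0\<close> it suffices that no colour is repeated within a ball.  Let \<open>H = H\<^sub>b\<close>.  By its
  construction \<open>H\<close> contains no quotient \<open>x y\<^sup>-\<^sup>1\<close> of distinct points of \<open>b\<close>, so it puts the points of
  \<open>b\<close> into distinct right cosets.  Every other ball is a left translate \<open>g b\<close>, whose quotients are
  the conjugates \<open>g x y\<^sup>-\<^sup>1 g\<^sup>-\<^sup>1\<close>; as \<open>H\<close> is normal, it separates the points of all balls at once
  (\<open>coset_map_inj_on_ball\<close>).  Hence colouring the \<open>n\<close> cosets of \<open>H\<close> with pairwise distinct colours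
  gives an \<open>H\<close>-periodic ground state (\<open>coset_colouring_ground_state\<close>), and there are
  \<open>q! / (q - n)!\<close> such colourings once \<open>q \<ge> n\<close>.  The \<open>K\<close> points of \<open>b\<close> lie in different cosets, so
  \<open>n \<ge> K\<close>, and therefore this number is at least \<open>q! / (q - K)!\<close>.  That a ball has exactly \<open>K\<close>
  points comes from counting reduced words of length at most \<open>r\<close>, which form the ball around the
  identity (\<open>tree_ball_one\<close>, \<open>card_tree_ball\<close>).
\<close>


section \<open>Subgroups of finite index\<close>

lemma (in group) rcos_eq_iff:
  assumes "subgroup H G" "x \<in> carrier G" "y \<in> carrier G"
  shows "H #> x = H #> y \<longleftrightarrow> x \<otimes> inv y \<in> H"
  using assms subgroup.rcos_module[OF assms(1) is_group assms(3,2)]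
  by (metis rcos_self repr_independence)

text \<open>
  A coset of an intersection is the intersection of the cosets of the members with the same
  representative, so it is determined by finitely many choices from finite sets.  The family must
  be nonempty, since an empty intersection is the whole type.
\<close>

lemma (in group) finite_rcosets_INT:
  assumes "finite I" "I \<noteq> {}"
    and sub: "\<And>i. i \<in> I \<Longrightarrow> subgroup (N i) G"
    and fin: "\<And>i. i \<in> I \<Longrightarrow> finite (rcosets (N i))"
  shows "finite (rcosets (\<Inter>i\<in>I. N i))"
proof -
  have eq: "(\<Inter>i\<in>I. N i) #> x = (\<Inter>i\<in>I. N i #> x)" if x: "x \<in> carrier G" for x
  proof
    show "(\<Inter>i\<in>I. N i) #> x \<subseteq> (\<Inter>i\<in>I. N i #> x)"
      by (auto simp: r_coset_def)
    show "(\<Inter>i\<in>I. N i #> x) \<subseteq> (\<Inter>i\<in>I. N i) #> x"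
    proof
      fix y assume y: "y \<in> (\<Inter>i\<in>I. N i #> x)"
      then have yG: "y \<in> carrier G"
        using \<open>I \<noteq> {}\<close> sub x by (metis INT_D ex_in_conv r_coset_subset_G subgroup.subset subsetD)
      have "y \<otimes> inv x \<in> N i" if "i \<in> I" for i
        using that y subgroup.rcos_module_imp[OF sub is_group x] by blast
      then have "(y \<otimes> inv x) \<otimes> x \<in> (\<Inter>i\<in>I. N i) #> x"
        unfolding r_coset_def by blast
      then show "y \<in> (\<Inter>i\<in>I. N i) #> x"
        using x yG by (simp add: m_assoc)
    qed
  qed
  have "rcosets (\<Inter>i\<in>I. N i) \<subseteq> (\<lambda>f. \<Inter>i\<in>I. f i) ` (\<Pi>\<^sub>E i\<in>I. rcosets (N i))"
  proof
    fix c assume "c \<in> rcosets (\<Inter>i\<in>I. N i)"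
    then obtain x where x: "x \<in> carrier G" and c: "c = (\<Inter>i\<in>I. N i) #> x"
      by (auto simp: RCOSETS_def)
    have "c = (\<Inter>i\<in>I. (\<lambda>i\<in>I. N i #> x) i)"
      unfolding c eq[OF x] by simp
    moreover have "(\<lambda>i\<in>I. N i #> x) \<in> (\<Pi>\<^sub>E i\<in>I. rcosets (N i))"
      using x by (auto simp: RCOSETS_def)
    ultimately show "c \<in> (\<lambda>f. \<Inter>i\<in>I. f i) ` (\<Pi>\<^sub>E i\<in>I. rcosets (N i))"
      by blast
  qed
  moreover have "finite ((\<lambda>f. \<Inter>i\<in>I. f i) ` (\<Pi>\<^sub>E i\<in>I. rcosets (N i)))"
    using assms(1) fin by (intro finite_imageI finite_PiE) auto
  ultimately show ?thesis
    by (rule finite_subset)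
qed

lemma (in group) normal_INT:
  assumes "I \<noteq> {}" "\<And>i. i \<in> I \<Longrightarrow> N i \<lhd> G"
  shows "(\<Inter>i\<in>I. N i) \<lhd> G"
proof (rule normal_invI)
  show "subgroup (\<Inter>i\<in>I. N i) G"
    using assms by (intro subgroups_Inter) (auto dest: normal_invE)
qed (use assms in \<open>auto dest: normal_invE\<close>)


section \<open>Balls of the Cayley tree\<close>

lemma length_letter_mult: "length (letter_mult a w) \<le> Suc (length w)"
  by (cases w) auto

lemma length_foldr_letter_mult: "length (foldr letter_mult u v) \<le> length u + length v"
proof (induction u)
  case (Cons a u)
  then show ?case
    using length_letter_mult[of a "foldr letter_mult u v"] by simp
qed simp

lemma foldr_letter_mult_append:
  "distinct_adj (u @ v) \<Longrightarrow> foldr letter_mult u v = u @ v"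
proof (induction u)
  case (Cons a u)
  then show ?case by (cases "u @ v") auto
qed simp

lemma edge_carrier:
  assumes "(x, y) \<in> edges k"
  shows "x \<in> carrier (cayley_group k)" "y \<in> carrier (cayley_group k)"
proof -
  show x: "x \<in> carrier (cayley_group k)"
    using assms by (simp add: edges_def)
  obtain i where i: "i \<in> {1..k + 1}" and y: "y = x \<otimes>\<^bsub>cayley_group k\<^esub> generator i"
    using assms by (auto simp: edges_def)
  have "generator i \<in> carrier (cayley_group k)"
    using i by (auto simp: generator_def cayley_group_def)
  then show "y \<in> carrier (cayley_group k)"
    using x y group.subgroup_self[OF group_cayley_group] by (simp add: subgroup.m_closed)
qed

text \<open>Edges multiply on the right, so left translations are automorphisms of the tree.\<close>

lemma edge_translate:
  assumes g: "g \<in> carrier (cayley_group k)" and e: "(x, y) \<in> edges k"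
  shows "(g \<otimes>\<^bsub>cayley_group k\<^esub> x, g \<otimes>\<^bsub>cayley_group k\<^esub> y) \<in> edges k"
proof -
  interpret group "cayley_group k" by (rule group_cayley_group)
  have gen: "generator i \<in> carrier (cayley_group k)" if "i \<in> {1..k + 1}" for i
    using that by (auto simp: generator_def cayley_group_def)
  show ?thesis
    using e g gen by (auto simp: edges_def m_assoc)
qed

lemma walk_translate:
  assumes "g \<in> carrier (cayley_group k)"
  shows "(x, y) \<in> edges k ^^ n \<Longrightarrow>
    (g \<otimes>\<^bsub>cayley_group k\<^esub> x, g \<otimes>\<^bsub>cayley_group k\<^esub> y) \<in> edges k ^^ n"
proof (induction n arbitrary: y)
  case (Suc n)
  then show ?case
    using edge_translate[OF assms] by (metis relpow_Suc_E relpow_Suc_I)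
qed simp

lemma tree_dist_translate:
  assumes "g \<in> carrier (cayley_group k)" "x \<in> carrier (cayley_group k)"
    "y \<in> carrier (cayley_group k)"
  shows "tree_dist k (g \<otimes>\<^bsub>cayley_group k\<^esub> x) (g \<otimes>\<^bsub>cayley_group k\<^esub> y) = tree_dist k x y"
proof -
  interpret group "cayley_group k" by (rule group_cayley_group)
  have "(g \<otimes>\<^bsub>cayley_group k\<^esub> x, g \<otimes>\<^bsub>cayley_group k\<^esub> y) \<in> edges k ^^ n
      \<longleftrightarrow> (x, y) \<in> edges k ^^ n" for n
    using walk_translate[of g k x y n] assms
      walk_translate[of "inv\<^bsub>cayley_group k\<^esub> g" k "g \<otimes>\<^bsub>cayley_group k\<^esub> x"
        "g \<otimes>\<^bsub>cayley_group k\<^esub> y" n]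
    by (auto simp: m_assoc[symmetric])
  then show ?thesis
    by (simp add: tree_dist_def)
qed

text \<open>Every element is reached from the identity by reading off its letters.\<close>

lemma walk_from_one:
  "w \<in> carrier (cayley_group k) \<Longrightarrow> ([], w) \<in> edges k ^^ length w"
proof (induction w rule: rev_induct)
  case (snoc i w)
  have w: "w \<in> carrier (cayley_group k)" and i: "i \<in> {1..k + 1}"
    using snoc.prems by (auto simp: cayley_group_def distinct_adj_append_iff)
  have "w @ [i] = w \<otimes>\<^bsub>cayley_group k\<^esub> generator i"
    using snoc.prems by (simp add: cayley_group_def generator_def foldr_letter_mult_append)
  then have "(w, w @ [i]) \<in> edges k"
    using w i by (auto simp: edges_def)
  with snoc.IH[OF w] show ?case
    by (simp add: relpow_Suc_I del: relpow.simps)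
qed simp

text \<open>
  Along an edge one letter is appended or cancelled, so a word cannot be reached from the identity
  in fewer steps than it has letters.
\<close>

lemma length_walk_le: "(x, y) \<in> edges k ^^ n \<Longrightarrow> length y \<le> length x + n"
proof (induction n arbitrary: y)
  case (Suc n)
  then obtain z where z: "(x, z) \<in> edges k ^^ n" "(z, y) \<in> edges k"
    by (auto elim: relpow_Suc_E)
  then obtain i where "y = foldr letter_mult z [i]"
    by (auto simp: edges_def cayley_group_def generator_def)
  then have "length y \<le> length z + 1"
    using length_foldr_letter_mult[of z "[i]"] by simp
  with Suc.IH[OF z(1)] show ?case by simp
qed simp

lemma tree_dist_one:
  assumes "w \<in> carrier (cayley_group k)"
  shows "tree_dist k [] w = length w"
  unfolding tree_dist_def
  using walk_from_one[OF assms] length_walk_le[of "[]" w _ k]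
  by (intro Least_equality) auto

lemma tree_ball_one:
  "tree_ball k r [] = {w \<in> carrier (cayley_group k). length w \<le> r}"
  by (auto simp: tree_ball_def tree_dist_one)

lemma tree_ball_translate:
  assumes g: "g \<in> carrier (cayley_group k)"
  shows "tree_ball k r g = (\<lambda>x. g \<otimes>\<^bsub>cayley_group k\<^esub> x) ` tree_ball k r []"
proof -
  interpret group "cayley_group k" by (rule group_cayley_group)
  have one: "[] = \<one>\<^bsub>cayley_group k\<^esub>"
    by (simp add: cayley_group_def)
  show ?thesis
  proof
    show "(\<lambda>x. g \<otimes>\<^bsub>cayley_group k\<^esub> x) ` tree_ball k r [] \<subseteq> tree_ball k r g"
      using g tree_dist_translate[OF g one_closed] by (auto simp: tree_ball_def one)
    show "tree_ball k r g \<subseteq> (\<lambda>x. g \<otimes>\<^bsub>cayley_group k\<^esub> x) ` tree_ball k r []"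
    proof
      fix y assume y: "y \<in> tree_ball k r g"
      then have yG: "y \<in> carrier (cayley_group k)"
        by (simp add: tree_ball_def)
      let ?x = "inv\<^bsub>cayley_group k\<^esub> g \<otimes>\<^bsub>cayley_group k\<^esub> y"
      have gx: "g \<otimes>\<^bsub>cayley_group k\<^esub> ?x = y"
        using g yG by (simp add: m_assoc[symmetric])
      then have "?x \<in> tree_ball k r []"
        using y g yG tree_dist_translate[OF g one_closed, of ?x]
        by (simp add: tree_ball_def one)
      with gx show "y \<in> (\<lambda>x. g \<otimes>\<^bsub>cayley_group k\<^esub> x) ` tree_ball k r []"
        by (metis image_eqI)
    qed
  qed
qed

lemma center_in_tree_ball: "x \<in> carrier (cayley_group k) \<Longrightarrow> x \<in> tree_ball k r x"
  by (simp add: tree_ball_def tree_dist_def Least_eq_0)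

lemma neighbour_in_tree_ball:
  assumes "(x, y) \<in> edges k" "r \<ge> 1"
  shows "y \<in> tree_ball k r x"
proof -
  have "tree_dist k x y \<le> 1"
    unfolding tree_dist_def using assms(1) by (intro Least_le) simp
  then show ?thesis
    using assms edge_carrier(2)[OF assms(1)] by (simp add: tree_ball_def)
qed

lemma ball_subset_carrier: "b \<in> balls k r \<Longrightarrow> b \<subseteq> carrier (cayley_group k)"
  by (auto simp: balls_def tree_ball_def)


section \<open>The number of vertices of a ball\<close>

definition reduced_words :: "nat \<Rightarrow> nat \<Rightarrow> nat list set" where
  "reduced_words k n = {w \<in> carrier (cayley_group k). length w = n}"

text \<open>
  The first letter is arbitrary among \<open>k + 1\<close>; each further letter has to avoid one neighbour,
  which leaves \<open>k\<close> choices.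
\<close>

lemma card_reduced_words:
  "finite (reduced_words k (Suc n)) \<and> card (reduced_words k (Suc n)) = (k + 1) * k ^ n"
proof (induction n)
  case 0
  have "reduced_words k (Suc 0) = (\<lambda>i. [i]) ` {1..k + 1}"
    by (auto simp: reduced_words_def cayley_group_def length_Suc_conv)
  then show ?case
    by (simp add: card_image inj_on_def)
next
  case (Suc n)
  let ?W = "reduced_words k (Suc n)"
  let ?P = "SIGMA w : ?W. {1..k + 1} - {hd w}"
  have "reduced_words k (Suc (Suc n)) = (\<lambda>(w, a). a # w) ` ?P"
  proof (intro subset_antisym subsetI)
    fix v assume v: "v \<in> reduced_words k (Suc (Suc n))"
    then obtain a w where v_eq: "v = a # w"
      by (cases v) (auto simp: reduced_words_def)
    have "(w, a) \<in> ?P"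
      using v unfolding v_eq by (cases w) (auto simp: reduced_words_def cayley_group_def)
    then show "v \<in> (\<lambda>(w, a). a # w) ` ?P"
      unfolding v_eq by (rule rev_image_eqI) simp
  next
    fix v assume "v \<in> (\<lambda>(w, a). a # w) ` ?P"
    then show "v \<in> reduced_words k (Suc (Suc n))"
      by (auto simp: reduced_words_def cayley_group_def distinct_adj_Cons)
  qed
  moreover have "inj_on (\<lambda>(w, a). a # w) ?P"
    by (auto simp: inj_on_def)
  moreover have "card ({1..k + 1} - {hd w}) = k" if "w \<in> ?W" for w
  proof -
    have "hd w \<in> {1..k + 1}"
      using that by (cases w) (auto simp: reduced_words_def cayley_group_def)
    then show ?thesis by simp
  qed
  ultimately show ?case
    using Suc by (simp add: card_image algebra_simps)
qed

lemma tree_ball_one_0: "tree_ball k 0 [] = {[]}"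
  by (auto simp: tree_ball_one cayley_group_def)

lemma tree_ball_one_Suc:
  "tree_ball k (Suc r) [] = tree_ball k r [] \<union> reduced_words k (Suc r)"
  by (auto simp: tree_ball_one reduced_words_def)

lemma finite_tree_ball_one: "finite (tree_ball k r [])"
  by (induction r) (auto simp: tree_ball_one_0 tree_ball_one_Suc card_reduced_words)

lemma card_tree_ball_one:
  assumes "k \<ge> 2"
  shows "card (tree_ball k r []) = ball_size k r"
proof -
  \<comment> \<open>The spheres contribute a geometric sum; it is summed after multiplication by \<open>k - 1\<close>.\<close>
  have "\<exists>s. card (tree_ball k r []) = 1 + (k + 1) * s \<and> (k - 1) * s + 1 = k ^ r"
  proof (induction r)
    case 0
    then show ?case by (simp add: tree_ball_one_0)
  next
    case (Suc r)
    then obtain s where s: "card (tree_ball k r []) = 1 + (k + 1) * s" "(k - 1) * s + 1 = k ^ r"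
      by blast
    have "card (tree_ball k (Suc r) []) = card (tree_ball k r []) + card (reduced_words k (Suc r))"
      unfolding tree_ball_one_Suc using card_reduced_words finite_tree_ball_one
      by (intro card_Un_disjoint) (auto simp: tree_ball_one reduced_words_def)
    then have "card (tree_ball k (Suc r) []) = 1 + (k + 1) * (s + k ^ r)"
      using s(1) card_reduced_words[of k r] by (simp add: algebra_simps)
    moreover have "(k - 1) * (s + k ^ r) + 1 = k ^ Suc r"
    proof -
      have "(k - 1) * (s + k ^ r) + 1 = k ^ r + (k - 1) * k ^ r"
        using s(2) by (simp add: distrib_left)
      also have "\<dots> = k ^ Suc r"
        using assms by (cases k) auto
      finally show ?thesis .
    qed
    ultimately show ?case by blast
  qed
  then obtain s where s: "card (tree_ball k r []) = 1 + (k + 1) * s" "(k - 1) * s + 1 = k ^ r"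
    by blast
  have "(k + 1) * (k ^ r - 1) = ((k + 1) * s) * (k - 1)"
    unfolding s(2)[symmetric] by (simp only: diff_add_inverse2 mult_ac)
  then show ?thesis
    using s(1) assms unfolding ball_size_def by simp
qed

lemma finite_ball: "b \<in> balls k r \<Longrightarrow> finite b"
  using finite_tree_ball_one by (auto simp: balls_def tree_ball_translate)

lemma card_tree_ball:
  assumes "k \<ge> 2" "b \<in> balls k r"
  shows "card b = ball_size k r"
proof -
  interpret group "cayley_group k" by (rule group_cayley_group)
  obtain g where g: "g \<in> carrier (cayley_group k)" and b: "b = tree_ball k r g"
    using assms(2) by (auto simp: balls_def)
  have "inj_on (\<lambda>x. g \<otimes>\<^bsub>cayley_group k\<^esub> x) (tree_ball k r [])"
    using g by (auto simp: inj_on_def tree_ball_def)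
  then show ?thesis
    unfolding b tree_ball_translate[OF g] using card_tree_ball_one[OF assms(1)]
    by (simp add: card_image)
qed


section \<open>Ground states as minimisers\<close>

text \<open>
  There are infinitely many configurations, but on one ball the energy depends only on the number
  of colours, which is at most \<open>q\<close>; so the minimum runs over a finite set and can be replaced by
  pointwise comparison.
\<close>

lemma ground_states_iff:
  "\<phi> \<in> ground_states k r q J \<longleftrightarrow>
     \<phi> \<in> configurations k q \<and> periodic k \<phi> \<and>
     (\<forall>b\<in>balls k r. \<forall>\<sigma>\<in>configurations k q. - J * U \<phi> b \<le> - J * U \<sigma> b)"
proof -
  have fin: "finite ((\<lambda>\<sigma>. - J * U \<sigma> b) ` configurations k q)" if b: "b \<in> balls k r" for b
  proof -
    have "card (\<sigma> ` b) \<le> q" if "\<sigma> \<in> configurations k q" for \<sigma>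
    proof -
      have "\<sigma> ` b \<subseteq> {1..q}"
        using that ball_subset_carrier[OF b] by (auto simp: configurations_def PiE_def)
      from card_mono[OF _ this] show ?thesis by simp
    qed
    then have "(\<lambda>\<sigma>. - J * U \<sigma> b) ` configurations k q
        \<subseteq> (\<lambda>m. - J * (real (card b) - real m)) ` {..q}"
      by (auto simp: U_def)
    then show ?thesis
      by (rule finite_subset) simp
  qed
  have "- J * U \<phi> b = Min ((\<lambda>\<sigma>. - J * U \<sigma> b) ` configurations k q) \<longleftrightarrow>
      (\<forall>\<sigma>\<in>configurations k q. - J * U \<phi> b \<le> - J * U \<sigma> b)"
    if "\<phi> \<in> configurations k q" "b \<in> balls k r" for b
    using eq_Min_iff[OF fin[OF that(2)], of "- J * U \<phi> b"] that(1) by blast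
  then show ?thesis
    unfolding ground_states_def by auto
qed


section \<open>Positive coupling: constant configurations\<close>

lemma periodic_constant: "periodic k (\<lambda>x\<in>carrier (cayley_group k). i)"
proof -
  interpret group "cayley_group k" by (rule group_cayley_group)
  have "rcosets\<^bsub>cayley_group k\<^esub> carrier (cayley_group k) \<subseteq> {carrier (cayley_group k)}"
    using coset_join2[OF _ subgroup_self] by (auto simp: RCOSETS_def)
  then have "periodic_wrt k (carrier (cayley_group k)) (\<lambda>x\<in>carrier (cayley_group k). i)"
    unfolding periodic_wrt_def using subgroup_self by (auto intro: finite_subset)
  then show ?thesis
    by (auto simp: periodic_def)
qed

lemma constant_on_edges_imp_constant:
  assumes "\<And>x y. (x, y) \<in> edges k \<Longrightarrow> \<phi> y = \<phi> x" "w \<in> carrier (cayley_group k)"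
  shows "\<phi> w = \<phi> []"
proof -
  have "(x, y) \<in> edges k ^^ n \<Longrightarrow> \<phi> y = \<phi> x" for x y n
  proof (induction n arbitrary: y)
    case (Suc n)
    then show ?case
      using assms(1) by (metis relpow_Suc_E)
  qed simp
  then show ?thesis
    using walk_from_one[OF assms(2)] by blast
qed

lemma ground_states_pos:
  assumes "r \<ge> 1" "q \<ge> 1" "J > 0"
  shows "ground_states k r q J = {(\<lambda>x\<in>carrier (cayley_group k). i) | i. i \<in> {1..q}}"
proof -
  let ?G = "carrier (cayley_group k)"
  have energy: "- J * U \<phi> b \<le> - J * U \<sigma> b \<longleftrightarrow> card (\<phi> ` b) \<le> card (\<sigma> ` b)" for \<phi> \<sigma> b
    using \<open>J > 0\<close> by (auto simp: U_def)
  have const_conf: "(\<lambda>x\<in>?G. i) \<in> configurations k q" if "i \<in> {1..q}" for i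
    using that by (auto simp: configurations_def)
  have image_const: "(\<lambda>x\<in>?G. i) ` b \<subseteq> {i}" if "b \<in> balls k r" for i b
    using ball_subset_carrier[OF that] by auto
  have card_const: "card ((\<lambda>x\<in>?G. i) ` b) \<le> 1" if "b \<in> balls k r" for i :: nat and b
    using card_mono[OF _ image_const[OF that]] by simp
  have card_pos: "card (\<sigma> ` b) \<ge> 1" if b: "b \<in> balls k r" for \<sigma> :: "nat list \<Rightarrow> nat" and b
  proof -
    have "b \<noteq> {}"
      using b center_in_tree_ball by (fastforce simp: balls_def)
    then show ?thesis
      using finite_ball[OF b] by (simp add: Suc_le_eq card_gt_0_iff)
  qed
  show ?thesis
  proof (intro subset_antisym subsetI)
    \<comment> \<open>Comparison with a constant configuration makes a ground state monochromatic on balls.\<close>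
    fix \<phi> assume \<phi>: "\<phi> \<in> ground_states k r q J"
    then have conf: "\<phi> \<in> configurations k q"
      by (simp add: ground_states_iff)
    have mono: "card (\<phi> ` b) \<le> 1" if b: "b \<in> balls k r" for b
    proof -
      have "(\<lambda>x\<in>?G. 1) \<in> configurations k q"
        by (rule const_conf) (use \<open>q \<ge> 1\<close> in simp)
      then have "card (\<phi> ` b) \<le> card ((\<lambda>x\<in>?G. 1 :: nat) ` b)"
        using \<phi> b unfolding ground_states_iff energy by blast
      also have "\<dots> \<le> 1"
        using card_const[OF b] .
      finally show ?thesis .
    qed
    have "\<phi> y = \<phi> x" if e: "(x, y) \<in> edges k" for x y
    proof -
      have b: "tree_ball k r x \<in> balls k r"
        using edge_carrier(1)[OF e] by (simp add: balls_def)
      have "x \<in> tree_ball k r x" "y \<in> tree_ball k r x"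
        using center_in_tree_ball[OF edge_carrier(1)[OF e]] neighbour_in_tree_ball[OF e \<open>r \<ge> 1\<close>]
        by auto
      then show ?thesis
        using mono[OF b] finite_ball[OF b]
        by (metis One_nat_def card_le_Suc0_iff_eq finite_imageI imageI)
    qed
    then have "\<phi> w = \<phi> []" if "w \<in> ?G" for w
      using constant_on_edges_imp_constant that by blast
    then have "\<phi> = (\<lambda>x\<in>?G. \<phi> [])"
      using conf by (auto simp: configurations_def PiE_def extensional_def restrict_def)
    moreover have "[] \<in> ?G"
      by (simp add: cayley_group_def)
    then have "\<phi> [] \<in> {1..q}"
      using conf unfolding configurations_def by (rule PiE_mem[rotated])
    ultimately show "\<phi> \<in> {(\<lambda>x\<in>?G. i) | i. i \<in> {1..q}}"
      by blast
  next
    fix \<phi> assume "\<phi> \<in> {(\<lambda>x\<in>?G. i) | i. i \<in> {1..q}}"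
    then obtain i where i: "i \<in> {1..q}" and \<phi>: "\<phi> = (\<lambda>x\<in>?G. i)"
      by blast
    show "\<phi> \<in> ground_states k r q J"
      unfolding ground_states_iff energy \<phi>
      using const_conf[OF i]
      by (intro conjI ballI periodic_constant order_trans[OF card_const card_pos])
  qed
qed


section \<open>Negative coupling: distinctly coloured cosets\<close>

text \<open>
  The quotients of the points of \<open>g A\<close> are conjugates of those of \<open>A\<close>, so a normal subgroup that
  separates the points of \<open>A\<close> also separates those of \<open>g A\<close>.
\<close>

lemma (in group) inj_on_rcos_translate:
  assumes "H \<lhd> G" "A \<subseteq> carrier G" "g \<in> carrier G"
    and "inj_on (\<lambda>x. H #> x) A"
  shows "inj_on (\<lambda>x. H #> x) ((\<lambda>x. g \<otimes> x) ` A)"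
proof (rule inj_onI; clarify)
  fix x y assume xy: "x \<in> A" "y \<in> A" and eq: "H #> (g \<otimes> x) = H #> (g \<otimes> y)"
  have G: "x \<in> carrier G" "y \<in> carrier G" and H: "subgroup H G"
    using xy assms normal_invE(1) by auto
  have "(g \<otimes> x) \<otimes> inv (g \<otimes> y) \<in> H"
    using eq rcos_eq_iff[OF H] G assms(3) by simp
  then have "inv g \<otimes> ((g \<otimes> x) \<otimes> inv (g \<otimes> y)) \<otimes> inv (inv g) \<in> H"
    using normal_invE(2)[OF assms(1)] assms(3) by blast
  moreover have "inv g \<otimes> ((g \<otimes> x) \<otimes> inv (g \<otimes> y)) \<otimes> inv (inv g) = x \<otimes> inv y"
    using G assms(3) by (simp add: inv_mult_group m_assoc inv_solve_left)
      (simp add: m_assoc[symmetric])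
  ultimately have "H #> x = H #> y"
    using rcos_eq_iff[OF H] G by simp
  with assms(4) xy show "g \<otimes> x = g \<otimes> y"
    by (auto dest: inj_onD)
qed

text \<open>
  For distinct \<open>x, y \<in> A\<close> the member \<open>N (x y\<^sup>-\<^sup>1)\<close> of the intersection already keeps the cosets of
  \<open>x\<close> and \<open>y\<close> apart.  Two points in \<open>A\<close> make the intersection range over a nonempty family.
\<close>

lemma subgroup_of_set_properties:
  assumes N: "separating_family k N" and A: "finite A" "A \<subseteq> carrier (cayley_group k)" "card A > 1"
  defines "H \<equiv> subgroup_of_set k N A"
  shows "H \<lhd> cayley_group k" "finite (rcosets\<^bsub>cayley_group k\<^esub> H)"
    "inj_on (\<lambda>x. H #>\<^bsub>cayley_group k\<^esub> x) A"
proof -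
  interpret group "cayley_group k" by (rule group_cayley_group)
  let ?I = "quotient_set k A - {\<one>\<^bsub>cayley_group k\<^esub>}"
  have "quotient_set k A =
      (\<lambda>(x, y). x \<otimes>\<^bsub>cayley_group k\<^esub> inv\<^bsub>cayley_group k\<^esub> y) ` (A \<times> A)"
    by (auto simp: quotient_set_def)
  then have fin: "finite ?I"
    using A(1) by simp
  have I: "?I \<subseteq> carrier (cayley_group k) - {\<one>\<^bsub>cayley_group k\<^esub>}"
    using A(2) by (auto simp: quotient_set_def)
  have quot: "x \<otimes>\<^bsub>cayley_group k\<^esub> inv\<^bsub>cayley_group k\<^esub> y \<in> ?I"
    if "x \<in> A" "y \<in> A" "x \<noteq> y" for x y
  proof -
    have "x \<otimes>\<^bsub>cayley_group k\<^esub> inv\<^bsub>cayley_group k\<^esub> y \<noteq> \<one>\<^bsub>cayley_group k\<^esub>"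
      using that A(2) by (metis inv_closed inv_equality inv_inv subsetD)
    then show ?thesis
      using that by (auto simp: quotient_set_def)
  qed
  obtain x y where "x \<in> A" "y \<in> A" "x \<noteq> y"
    using A(1,3) by (metis One_nat_def card_le_Suc0_iff_eq not_le)
  then have ne: "?I \<noteq> {}"
    using quot by blast
  have NI: "N i \<lhd> cayley_group k" "finite (rcosets\<^bsub>cayley_group k\<^esub> (N i))" "i \<notin> N i"
    if "i \<in> ?I" for i
    using N I that unfolding separating_family_def by blast+
  show normal: "H \<lhd> cayley_group k"
    unfolding H_def subgroup_of_set_def using ne NI by (intro normal_INT) auto
  show "finite (rcosets\<^bsub>cayley_group k\<^esub> H)"
    unfolding H_def subgroup_of_set_def using fin ne NI normal_invE(1)
    by (intro finite_rcosets_INT) auto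
  show "inj_on (\<lambda>x. H #>\<^bsub>cayley_group k\<^esub> x) A"
  proof (rule inj_onI, rule ccontr)
    fix x y
    assume xy: "x \<in> A" "y \<in> A" "x \<noteq> y"
      and eq: "H #>\<^bsub>cayley_group k\<^esub> x = H #>\<^bsub>cayley_group k\<^esub> y"
    have "x \<otimes>\<^bsub>cayley_group k\<^esub> inv\<^bsub>cayley_group k\<^esub> y \<in> H"
      using rcos_eq_iff[OF normal_invE(1)[OF normal]] eq xy A(2) by blast
    then have "x \<otimes>\<^bsub>cayley_group k\<^esub> inv\<^bsub>cayley_group k\<^esub> y
        \<in> N (x \<otimes>\<^bsub>cayley_group k\<^esub> inv\<^bsub>cayley_group k\<^esub> y)"
      using quot[OF xy] unfolding H_def subgroup_of_set_def by blast
    with NI(3)[OF quot[OF xy]] show False by blast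
  qed
qed

lemma ground_subgroupI:
  assumes H: "subgroup H (cayley_group k)" and A: "finite A" "A \<subseteq> carrier (cayley_group k)"
    and inj: "inj_on (\<lambda>x. H #>\<^bsub>cayley_group k\<^esub> x) A"
  shows "ground_subgroup k A H"
proof -
  interpret group "cayley_group k" by (rule group_cayley_group)
  let ?C = "(\<lambda>x. H #>\<^bsub>cayley_group k\<^esub> x) ` A"
  have "?C \<subseteq> rcosets\<^bsub>cayley_group k\<^esub> H"
    using A(2) by (auto simp: RCOSETS_def)
  moreover have "card ?C = card A"
    using inj by (rule card_image)
  moreover have "card (c \<inter> A) = 1" if c_in: "c \<in> ?C" for c
  proof -
    obtain x where x: "x \<in> A" and c: "c = H #>\<^bsub>cayley_group k\<^esub> x"
      using c_in by blast
    have "y = x" if "y \<in> A" "y \<in> H #>\<^bsub>cayley_group k\<^esub> x" for y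
      using repr_independence[OF that(2) _ H] inj x that(1) A(2) by (auto dest: inj_onD)
    then have "c \<inter> A = {x}"
      using x rcos_self[OF _ H] A(2) unfolding c by blast
    then show ?thesis by simp
  qed
  ultimately show ?thesis
    unfolding ground_subgroup_def using H A(1) by blast
qed

text \<open>The ball around \<open>g'\<close> is the translate by \<open>g' g\<^sup>-\<^sup>1\<close> of the ball around \<open>g\<close>.\<close>

lemma coset_map_inj_on_ball:
  assumes H: "H \<lhd> cayley_group k" and b: "b \<in> balls k r"
    and inj: "inj_on (\<lambda>x. H #>\<^bsub>cayley_group k\<^esub> x) b" and b': "b' \<in> balls k r"
  shows "inj_on (\<lambda>x. H #>\<^bsub>cayley_group k\<^esub> x) b'"
proof -
  interpret group "cayley_group k" by (rule group_cayley_group)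
  obtain g where g: "g \<in> carrier (cayley_group k)" and gb: "b = tree_ball k r g"
    using b by (auto simp: balls_def)
  obtain g' where g': "g' \<in> carrier (cayley_group k)" and gb': "b' = tree_ball k r g'"
    using b' by (auto simp: balls_def)
  let ?h = "g' \<otimes>\<^bsub>cayley_group k\<^esub> inv\<^bsub>cayley_group k\<^esub> g"
  have "?h \<otimes>\<^bsub>cayley_group k\<^esub> (g \<otimes>\<^bsub>cayley_group k\<^esub> x) = g' \<otimes>\<^bsub>cayley_group k\<^esub> x"
    if "x \<in> tree_ball k r []" for x
  proof -
    have "x \<in> carrier (cayley_group k)"
      using that by (simp add: tree_ball_def)
    then have "inv\<^bsub>cayley_group k\<^esub> g \<otimes>\<^bsub>cayley_group k\<^esub> (g \<otimes>\<^bsub>cayley_group k\<^esub> x) = x"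
      using g by (simp add: m_assoc[symmetric])
    then show ?thesis
      using g g' \<open>x \<in> carrier (cayley_group k)\<close> by (simp add: m_assoc)
  qed
  then have "b' = (\<lambda>x. ?h \<otimes>\<^bsub>cayley_group k\<^esub> x) ` b"
    unfolding gb gb' tree_ball_translate[OF g] tree_ball_translate[OF g'] image_image
    by (intro image_cong) auto
  then show ?thesis
    using inj_on_rcos_translate[OF H ball_subset_carrier[OF b] _ inj, of ?h] g g' by simp
qed

definition coset_colouring ::
    "nat \<Rightarrow> nat list set \<Rightarrow> (nat list set \<Rightarrow> nat) \<Rightarrow> nat list \<Rightarrow> nat" where
  "coset_colouring k H f = (\<lambda>x\<in>carrier (cayley_group k). f (H #>\<^bsub>cayley_group k\<^esub> x))"

lemma coset_colouring_periodic:
  assumes H: "subgroup H (cayley_group k)" and fin: "finite (rcosets\<^bsub>cayley_group k\<^esub> H)"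
  shows "periodic_wrt k H (coset_colouring k H f)"
proof -
  interpret group "cayley_group k" by (rule group_cayley_group)
  have "H #>\<^bsub>cayley_group k\<^esub> (h \<otimes>\<^bsub>cayley_group k\<^esub> x) = H #>\<^bsub>cayley_group k\<^esub> x"
    if "h \<in> H" "x \<in> carrier (cayley_group k)" for h x
    using repr_independence[OF rcosI[OF that(1) subgroup.subset[OF H] that(2)] that(2) H] by simp
  then show ?thesis
    unfolding periodic_wrt_def coset_colouring_def
    using H fin subgroup.mem_carrier[OF H] by auto
qed

text \<open>
  Where neither the cosets nor the colours repeat within a ball, the energy takes the value \<open>0\<close>,
  and for \<open>J < 0\<close> no energy is negative.
\<close>

lemma coset_colouring_ground_state:
  assumes "J < 0" and H: "subgroup H (cayley_group k)"
    and fin: "finite (rcosets\<^bsub>cayley_group k\<^esub> H)"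
    and inj: "\<And>b. b \<in> balls k r \<Longrightarrow> inj_on (\<lambda>x. H #>\<^bsub>cayley_group k\<^esub> x) b"
    and f: "f \<in> (rcosets\<^bsub>cayley_group k\<^esub> H) \<rightarrow>\<^sub>E {1..q}"
      "inj_on f (rcosets\<^bsub>cayley_group k\<^esub> H)"
  shows "coset_colouring k H f \<in> ground_states k r q J"
  unfolding ground_states_iff
proof (intro conjI ballI)
  show "coset_colouring k H f \<in> configurations k q"
    using f(1) by (auto simp: configurations_def coset_colouring_def RCOSETS_def PiE_def Pi_def)
  show "periodic k (coset_colouring k H f)"
    using coset_colouring_periodic[OF H fin] by (auto simp: periodic_def)
  fix b \<sigma> assume b: "b \<in> balls k r"
  have bG: "b \<subseteq> carrier (cayley_group k)"
    using ball_subset_carrier[OF b] .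
  have "(\<lambda>x. H #>\<^bsub>cayley_group k\<^esub> x) ` b \<subseteq> rcosets\<^bsub>cayley_group k\<^esub> H"
    using bG by (auto simp: RCOSETS_def)
  then have "inj_on (f \<circ> (\<lambda>x. H #>\<^bsub>cayley_group k\<^esub> x)) b"
    using inj[OF b] f(2) by (blast intro: comp_inj_on inj_on_subset)
  then have "inj_on (coset_colouring k H f) b"
    by (rule inj_on_cong[THEN iffD1, rotated]) (use bG in \<open>auto simp: coset_colouring_def\<close>)
  then have "U (coset_colouring k H f) b = 0"
    by (simp add: U_def card_image)
  moreover have "U \<sigma> b \<ge> 0"
    using card_image_le[OF finite_ball[OF b]] by (simp add: U_def)
  ultimately show "- J * U (coset_colouring k H f) b \<le> - J * U \<sigma> b"
    using \<open>J < 0\<close> by (simp add: mult_nonpos_nonneg)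
qed

lemma coset_colouring_inj:
  "inj_on (coset_colouring k H) ((rcosets\<^bsub>cayley_group k\<^esub> H) \<rightarrow>\<^sub>E C)"
proof (rule inj_onI, rule PiE_ext)
  fix f g c
  assume eq: "coset_colouring k H f = coset_colouring k H g"
    and "c \<in> rcosets\<^bsub>cayley_group k\<^esub> H"
  then obtain x where "x \<in> carrier (cayley_group k)" "c = H #>\<^bsub>cayley_group k\<^esub> x"
    by (auto simp: RCOSETS_def)
  then show "f c = g c"
    using fun_cong[OF eq, of x] by (simp add: coset_colouring_def)
qed

text \<open>
  An \<open>H\<close>-periodic configuration is determined by its values on the finitely many cosets.  Without
  finiteness a cardinality would bound nothing, since \<open>card\<close> is \<open>0\<close> on infinite sets.
\<close>

lemma finite_periodic_configurations:
  assumes "finite (rcosets\<^bsub>cayley_group k\<^esub> H)"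
  shows "finite {\<phi> \<in> configurations k q. periodic_wrt k H \<phi>}"
proof -
  interpret group "cayley_group k" by (rule group_cayley_group)
  let ?R = "rcosets\<^bsub>cayley_group k\<^esub> H"
  have "{\<phi> \<in> configurations k q. periodic_wrt k H \<phi>} \<subseteq> coset_colouring k H ` (?R \<rightarrow>\<^sub>E {1..q})"
  proof clarify
    fix \<phi> assume \<phi>: "\<phi> \<in> configurations k q" and per: "periodic_wrt k H \<phi>"
    have H: "subgroup H (cayley_group k)"
      using per by (simp add: periodic_wrt_def)
    \<comment> \<open>By periodicity the colour of any representative is the colour of its coset.\<close>
    let ?rep = "\<lambda>c. SOME x. x \<in> c"
    let ?f = "\<lambda>c\<in>?R. \<phi> (?rep c)"
    have rep: "?rep (H #>\<^bsub>cayley_group k\<^esub> x) \<in> H #>\<^bsub>cayley_group k\<^esub> x"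
      if "x \<in> carrier (cayley_group k)" for x
      using rcos_self[OF that H] by (rule someI)
    have val: "\<phi> (?rep (H #>\<^bsub>cayley_group k\<^esub> x)) = \<phi> x"
      if "x \<in> carrier (cayley_group k)" for x
      using rep[OF that] per that unfolding periodic_wrt_def r_coset_def by force
    have f: "?f \<in> ?R \<rightarrow>\<^sub>E {1..q}"
      using \<phi> val by (auto simp: RCOSETS_def configurations_def PiE_def Pi_def)
    have "\<phi> = coset_colouring k H ?f"
    proof
      fix x show "\<phi> x = coset_colouring k H ?f x"
        using \<phi> val[of x]
        by (cases "x \<in> carrier (cayley_group k)")
          (auto simp: coset_colouring_def RCOSETS_def configurations_def PiE_def extensional_def)
    qed
    with f show "\<phi> \<in> coset_colouring k H ` (?R \<rightarrow>\<^sub>E {1..q})"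
      by blast
  qed
  then show ?thesis
    by (rule finite_subset) (use assms in \<open>intro finite_imageI finite_PiE; simp\<close>)
qed

lemma prod_diff_mult_fact:
  "n \<le> q \<Longrightarrow> prod ((-) q) {0..<n} * fact (q - n) = (fact q :: nat)"
proof (induction n)
  case (Suc n)
  have "fact (q - n) = (q - n) * (fact (q - Suc n) :: nat)"
    using Suc.prems by (simp add: fact_reduce[of "q - n"])
  then show ?case
    using Suc by (simp add: mult.assoc)
qed simp

lemma card_injections:
  assumes "finite R" "card R \<le> q"
  shows "real (card {f \<in> R \<rightarrow>\<^sub>E {1..q}. inj_on f R}) = fact q / fact (q - card R)"
proof -
  have "card {f \<in> R \<rightarrow>\<^sub>E {1..q}. inj_on f R} = prod ((-) q) {0..<card R}"
    using card_inj_on_subset_funcset[OF assms(1) finite_atLeastAtMost[of 1 q] subset_refl] by simp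
  then have "card {f \<in> R \<rightarrow>\<^sub>E {1..q}. inj_on f R} * fact (q - card R) = (fact q :: nat)"
    using prod_diff_mult_fact[OF assms(2)] by simp
  from arg_cong[OF this, of real]
  have "real (card {f \<in> R \<rightarrow>\<^sub>E {1..q}. inj_on f R}) * fact (q - card R) = fact q"
    by (simp only: of_nat_mult of_nat_fact)
  then show ?thesis
    by (simp add: field_simps)
qed

lemma card_periodic_ground_states_ge:
  assumes "J < 0" and H: "subgroup H (cayley_group k)"
    and fin: "finite (rcosets\<^bsub>cayley_group k\<^esub> H)" and q: "card (rcosets\<^bsub>cayley_group k\<^esub> H) \<le> q"
    and inj: "\<And>b. b \<in> balls k r \<Longrightarrow> inj_on (\<lambda>x. H #>\<^bsub>cayley_group k\<^esub> x) b"
  shows "fact q / fact (q - card (rcosets\<^bsub>cayley_group k\<^esub> H)) \<le>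
    real (card {\<phi> \<in> ground_states k r q J. periodic_wrt k H \<phi>})"
proof -
  let ?R = "rcosets\<^bsub>cayley_group k\<^esub> H"
  let ?F = "{f \<in> ?R \<rightarrow>\<^sub>E {1..q}. inj_on f ?R}"
  let ?S = "{\<phi> \<in> ground_states k r q J. periodic_wrt k H \<phi>}"
  have "coset_colouring k H ` ?F \<subseteq> ?S"
    using coset_colouring_ground_state[OF \<open>J < 0\<close> H fin inj] coset_colouring_periodic[OF H fin]
    by blast
  moreover have "inj_on (coset_colouring k H) ?F"
    using coset_colouring_inj by (rule inj_on_subset) blast
  moreover have "finite ?S"
    by (rule finite_subset[OF _ finite_periodic_configurations[OF fin]])
      (auto simp: ground_states_iff)
  ultimately have "card ?F \<le> card ?S"
    by (intro card_inj_on_le)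
  then show ?thesis
    unfolding card_injections[OF fin q, symmetric] by simp
qed


section \<open>The ground states of the model\<close>

theorem theorem6p1:
  fixes k r :: nat
  assumes "k \<ge> 2" and "r \<ge> 1"
  shows "(\<forall>q\<ge>1. \<forall>J::real. J > 0 \<longrightarrow>
            ground_states k r q J = {(\<lambda>x\<in>carrier (cayley_group k). i) | i. i \<in> {1..q}})
       \<and> (\<forall>N. separating_family k N \<longrightarrow>
            (\<forall>b\<in>balls k r.
               ground_subgroup k b (subgroup_of_set k N b) \<and>
               (\<exists>q\<^sub>0\<ge>ball_size k r. \<forall>q\<ge>q\<^sub>0. \<forall>J::real. J < 0 \<longrightarrow>
                  fact q / fact (q - ball_size k r) \<le>
                  real (card {\<phi> \<in> ground_states k r q J.
                               periodic_wrt k (subgroup_of_set k N b) \<phi>}))))"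
proof (intro conjI allI impI ballI)
  fix q :: nat and J :: real
  assume "1 \<le> q" "0 < J"
  with \<open>r \<ge> 1\<close>
  show "ground_states k r q J = {(\<lambda>x\<in>carrier (cayley_group k). i) | i. i \<in> {1..q}}"
    by (rule ground_states_pos)
next
  fix N b assume N: "separating_family k N" and b: "b \<in> balls k r"
  have card_b: "card b = ball_size k r"
    using \<open>k \<ge> 2\<close> b by (rule card_tree_ball)
  \<comment> \<open>As \<open>r \<ge> 1\<close>, a ball has more than one point, so its quotient set is not just the identity.\<close>
  have "k ^ 1 \<le> k ^ r"
    using assms by (intro power_increasing) auto
  then have "k - 1 \<le> (k + 1) * (k ^ r - 1)"
    using mult_le_mono[of 1 "k + 1" "k - 1" "k ^ r - 1"] by (simp only: power_one_right mult_1)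
  then have "card b > 1"
    using \<open>k \<ge> 2\<close> div_le_mono[of "k - 1" "(k + 1) * (k ^ r - 1)" "k - 1"]
    unfolding card_b ball_size_def by simp
  note props = subgroup_of_set_properties[OF N finite_ball[OF b] ball_subset_carrier[OF b] this]
  let ?H = "subgroup_of_set k N b"
  let ?n = "card (rcosets\<^bsub>cayley_group k\<^esub> ?H)"
  have sub: "subgroup ?H (cayley_group k)"
    using group.normal_invE(1)[OF group_cayley_group props(1)] .
  show "ground_subgroup k b ?H"
    using sub finite_ball[OF b] ball_subset_carrier[OF b] props(3) by (rule ground_subgroupI)
  have "(\<lambda>x. ?H #>\<^bsub>cayley_group k\<^esub> x) \<in> b \<rightarrow> rcosets\<^bsub>cayley_group k\<^esub> ?H"
    using ball_subset_carrier[OF b] by (auto simp: RCOSETS_def)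
  then have K: "ball_size k r \<le> ?n"
    using card_inj[OF _ props(3,2)] card_b by simp
  have "fact q / fact (q - ball_size k r) \<le>
      real (card {\<phi> \<in> ground_states k r q J. periodic_wrt k ?H \<phi>})"
    if q: "q \<ge> ?n" and "J < 0" for q and J :: real
  proof -
    have "(fact (q - ?n) :: real) \<le> fact (q - ball_size k r)"
      using K by (intro fact_mono) simp
    then have "(fact q :: real) / fact (q - ball_size k r) \<le> fact q / fact (q - ?n)"
      by (intro divide_left_mono) auto
    also have "\<dots> \<le> real (card {\<phi> \<in> ground_states k r q J. periodic_wrt k ?H \<phi>})"
      using \<open>J < 0\<close> sub props(2) q coset_map_inj_on_ball[OF props(1) b props(3)]
      by (rule card_periodic_ground_states_ge)
    finally show ?thesis .
  qed
  \<comment> \<open>The threshold \<open>q\<^sub>0\<close> is the index of \<open>H\<^sub>b\<close>.\<close>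
  with K show "\<exists>q\<^sub>0\<ge>ball_size k r. \<forall>q\<ge>q\<^sub>0. \<forall>J::real. J < 0 \<longrightarrow>
      fact q / fact (q - ball_size k r) \<le>
      real (card {\<phi> \<in> ground_states k r q J. periodic_wrt k ?H \<phi>})"
    by blast
qed

end
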